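(* Let $w_*:\mathbb{N}\to\mathbb{R}$ denote any one of the functions $w_s$, $w_p$, or $w_c$. Then the limit $\lim_{d\to\infty} w_*(d)/d$ exists and \[\lim_{d\to\infty}\frac{w_*(d)}{d}=\sup_{d\in\mathbb{N}}\frac{w_*(d)}{d}.\]
   Context: All notions are with respect to the lattice $\mathbb{Z}^d$. A convex body is hollow if its interior contains no lattice point. The lattice width of a convex body $K\subset\mathbb{R}^d$ is $\inf_{f\in(\mathbb{Z}^d)^*\setminus\{0\}}(\max_K f-\min_K f)$. $w_c(d)$ is the supremum of the lattice widths of hollow convex bodies in $\mathbb{R}^d$ (finite by the flatness theorem); $w_p(d)$ is the maximum lattice width of hollow lattice $d$-polytopes (polytopes with vertices in $\mathbb{Z}^d$); $w_s(d)$ is the maximum lattice width of hollow lattice $d$-simplices. *)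

theory Defs
  imports "HOL-Analysis.Analysis" "HOL-Analysis.Finite_Function_Topology"
begin

text \<open>Since the dimension \<open>d\<close> varies inside the statement, \<open>\<real>\<^sup>d\<close> is the subspace of the
  finitely supported real sequences that vanish outside \<open>{..<d}\<close>. The ambient norm is the
  \<open>\<ell>\<^sup>1\<close> norm, which induces the usual topology on each of these finite-dimensional subspaces.\<close>

type_synonym vect = "nat \<Rightarrow>\<^sub>0 real"

definition space_R :: "nat \<Rightarrow> vect set" where
  "space_R d = {x. Poly_Mapping.keys x \<subseteq> {..<d}}"

definition lattice_Z :: "nat \<Rightarrow> vect set" where
  "lattice_Z d = {x \<in> space_R d. \<forall>i. poly_mapping.lookup x i \<in> \<int>}"

text \<open>Interiors are taken relative to \<open>\<real>\<^sup>d\<close>, not in the ambient space (where they would be empty).\<close>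

definition interior_R :: "nat \<Rightarrow> vect set \<Rightarrow> vect set" where
  "interior_R d K = top_of_set (space_R d) interior_of K"

text \<open>Convex bodies are full-dimensional, as they must be for the flatness theorem to hold.\<close>

definition convex_body :: "nat \<Rightarrow> vect set \<Rightarrow> bool" where
  "convex_body d K \<longleftrightarrow> K \<subseteq> space_R d \<and> convex K \<and> compact K \<and> interior_R d K \<noteq> {}"

definition hollow :: "nat \<Rightarrow> vect set \<Rightarrow> bool" where
  "hollow d K \<longleftrightarrow> interior_R d K \<inter> lattice_Z d = {}"

text \<open>The nonzero elements of \<open>(\<int>\<^sup>d)\<^sup>*\<close>, extended linearly to real functionals. Only their
  restrictions to \<open>\<real>\<^sup>d\<close> matter, so ``nonzero'' means not vanishing on \<open>\<int>\<^sup>d\<close>; the values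
  outside \<open>\<real>\<^sup>d\<close> are irrelevant.\<close>

definition nonzero_dual :: "nat \<Rightarrow> (vect \<Rightarrow> real) set" where
  "nonzero_dual d =
     {f. linear f \<and> (\<forall>x\<in>lattice_Z d. f x \<in> \<int>) \<and> (\<exists>x\<in>lattice_Z d. f x \<noteq> 0)}"

text \<open>For compact nonempty \<open>K\<close>, supremum and infimum of \<open>f\<close> on \<open>K\<close> are its maximum and minimum.\<close>

definition lattice_width :: "nat \<Rightarrow> vect set \<Rightarrow> real" where
  "lattice_width d K = (INF f\<in>nonzero_dual d. (SUP x\<in>K. f x) - (INF x\<in>K. f x))"

text \<open>A polytope in \<open>\<real>\<^sup>d\<close> is a \<open>d\<close>-polytope, i.e. of dimension \<open>d\<close>, iff its affine hull is all of
  \<open>\<real>\<^sup>d\<close>. Its vertices are its extreme points.\<close>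

definition lattice_polytope :: "nat \<Rightarrow> vect set \<Rightarrow> bool" where
  "lattice_polytope d K \<longleftrightarrow>
     polytope K \<and> affine hull K = space_R d \<and> (\<forall>v. v extreme_point_of K \<longrightarrow> v \<in> lattice_Z d)"

text \<open>The second conjunct is what the library's \<open>int d simplex K\<close> unfolds to; the latter is only
  available for types of class \<open>euclidean_space\<close>.\<close>

definition lattice_simplex :: "nat \<Rightarrow> vect set \<Rightarrow> bool" where
  "lattice_simplex d K \<longleftrightarrow>
     lattice_polytope d K \<and>
     (\<exists>C. \<not> affine_dependent C \<and> int (card C) = int d + 1 \<and> K = convex hull C)"

text \<open>The suprema are taken in the extended reals, so that they are meaningful without appealing to
  the flatness theorem; by that theorem they are finite for \<open>d \<ge> 1\<close>. Lattice widths of lattice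
  polytopes are integers, so the suprema \<open>w_p d\<close> and \<open>w_s d\<close> are then maxima.\<close>

definition w_c :: "nat \<Rightarrow> ereal" where
  "w_c d = (SUP K \<in> {K. convex_body d K \<and> hollow d K}. ereal (lattice_width d K))"

definition w_p :: "nat \<Rightarrow> ereal" where
  "w_p d = (SUP K \<in> {K. lattice_polytope d K \<and> hollow d K}. ereal (lattice_width d K))"

definition w_s :: "nat \<Rightarrow> ereal" where
  "w_s d = (SUP K \<in> {K. lattice_simplex d K \<and> hollow d K}. ereal (lattice_width d K))"

end

theory Submission
  imports Defs
begin

text \<open>For bodies \<open>L\<close>, \<open>K\<close> containing the origin, the direct sum \<open>conv (L \<times> 0 \<union> 0 \<times> K)\<close> has width
  at least the smaller of the two widths, and if \<open>a L\<close> and \<open>b K\<close> are hollow, then so is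
  \<open>(a + b) (L \<oplus> K)\<close>: a point of it has components in \<open>\<alpha> L\<close> and \<open>\<beta> K\<close> with \<open>\<alpha> + \<beta> = a + b\<close>, so
  \<open>\<alpha> \<le> a\<close> or \<open>\<beta> \<le> b\<close>. Thus the \<open>m\<close>-fold sum of a hollow body, dilated by \<open>m\<close>, is hollow of
  width at least \<open>m\<close> times the original one, and stays a lattice polytope or simplex. Taking \<open>b = 0\<close>
  and \<open>K\<close> a long segment yields pyramids, which raise the dimension by one without decreasing a
  prescribed width. Hence \<open>w (m d + r) \<ge> m w d\<close>, from which the limit follows as in Fekete's lemma.
  The same holds when hollowness is taken with respect to a translated lattice; this allows
  placing the origin anywhere in a convex body.\<close>

section \<open>Coordinates and shifts\<close>

lemma lookup_scaleR [simp]: "poly_mapping.lookup (r *\<^sub>R x) i = r *\<^sub>R poly_mapping.lookup x i"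
proof -
  have "finite {i. r *\<^sub>R poly_mapping.lookup x i \<noteq> 0}"
    by (rule finite_subset[OF _ finite_lookup[of x]]) auto
  then show ?thesis
    by (simp add: scaleR_poly_mapping_def)
qed

lemma linear_lookup: "linear (\<lambda>x::'a \<Rightarrow>\<^sub>0 'b::real_vector. poly_mapping.lookup x i)"
  by (rule linearI) (auto simp: lookup_add)

abbreviation unit :: "nat \<Rightarrow> vect" where
  "unit i \<equiv> Poly_Mapping.single i 1"

lemma space_R_iff: "x \<in> space_R d \<longleftrightarrow> (\<forall>i\<ge>d. poly_mapping.lookup x i = 0)"
  by (auto simp: space_R_def in_keys_iff subset_iff not_less) (meson not_le)

lemma subspace_space_R: "subspace (space_R d)"
  by (auto simp: subspace_def space_R_iff lookup_add)

lemma zero_space_R [simp]: "0 \<in> space_R d"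
  by (simp add: space_R_iff)

lemma space_R_mono: "p \<le> q \<Longrightarrow> space_R p \<subseteq> space_R q"
  by (auto simp: space_R_iff)

lemma unit_space_R: "i < d \<Longrightarrow> unit i \<in> space_R d"
  by (auto simp: space_R_iff lookup_single when_def)

lemma space_R_expansion:
  assumes "x \<in> space_R d"
  shows "x = (\<Sum>i<d. poly_mapping.lookup x i *\<^sub>R unit i)"
proof (rule poly_mapping_eqI)
  fix k
  have "poly_mapping.lookup (\<Sum>i<d. poly_mapping.lookup x i *\<^sub>R unit i) k
      = (\<Sum>i<d. if i = k then poly_mapping.lookup x i else 0)"
    by (simp add: lookup_sum lookup_single when_def if_distrib cong: if_cong)
  then show "poly_mapping.lookup x k = poly_mapping.lookup (\<Sum>i<d. poly_mapping.lookup x i *\<^sub>R unit i) k"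
    using assms by (auto simp: space_R_iff)
qed

lemma norm_space_R:
  assumes "x \<in> space_R d"
  shows "norm x = (\<Sum>i<d. \<bar>poly_mapping.lookup x i\<bar>)"
proof -
  have "norm x = (\<Sum>i\<in>Poly_Mapping.keys x. \<bar>poly_mapping.lookup x i\<bar>)"
    by (simp add: norm_poly_mapping_def dist_poly_mapping_def)
  also have "\<dots> = (\<Sum>i<d. \<bar>poly_mapping.lookup x i\<bar>)"
    using assms by (intro sum.mono_neutral_left) (auto simp: space_R_def in_keys_iff)
  finally show ?thesis .
qed

lemma lattice_Z_add: "x \<in> lattice_Z d \<Longrightarrow> y \<in> lattice_Z d \<Longrightarrow> x + y \<in> lattice_Z d"
  by (auto simp: lattice_Z_def lookup_add intro: subspace_add[OF subspace_space_R])

lemma lattice_Z_uminus: "x \<in> lattice_Z d \<Longrightarrow> - x \<in> lattice_Z d"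
  by (auto simp: lattice_Z_def intro: subspace_neg[OF subspace_space_R])

lemma lattice_Z_diff: "x \<in> lattice_Z d \<Longrightarrow> y \<in> lattice_Z d \<Longrightarrow> x - y \<in> lattice_Z d"
  using lattice_Z_add[OF _ lattice_Z_uminus] by force

lemma lattice_Z_scale: "x \<in> lattice_Z d \<Longrightarrow> real n *\<^sub>R x \<in> lattice_Z d"
  by (auto simp: lattice_Z_def intro: subspace_scale[OF subspace_space_R])

lemma zero_lattice_Z [simp]: "0 \<in> lattice_Z d"
  by (simp add: lattice_Z_def)

lemma lattice_Z_subset: "lattice_Z d \<subseteq> space_R d"
  by (auto simp: lattice_Z_def)

lemma lattice_Z_mono: "p \<le> q \<Longrightarrow> lattice_Z p \<subseteq> lattice_Z q"
  using space_R_mono by (auto simp: lattice_Z_def)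

lemma unit_lattice_Z: "i < d \<Longrightarrow> unit i \<in> lattice_Z d"
  by (auto simp: lattice_Z_def unit_space_R lookup_single when_def)

lift_definition shift :: "nat \<Rightarrow> vect \<Rightarrow> vect" is
  "\<lambda>p x i. if i < p then 0 else x (i - p)"
proof -
  fix p and x :: "nat \<Rightarrow> real"
  assume "finite {i. x i \<noteq> 0}"
  then have "finite ((\<lambda>i. i + p) ` {i. x i \<noteq> 0})"
    by (rule finite_imageI)
  then show "finite {i. (if i < p then 0 else x (i - p)) \<noteq> 0}"
    by (rule rev_finite_subset) (force intro: image_eqI[of i _ "i - p" for i] split: if_splits)
qed

lemma linear_shift: "linear (shift p)"
  by (rule linearI; rule poly_mapping_eqI) (auto simp: shift.rep_eq lookup_add)

lemma inj_shift: "inj (shift p)"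
proof (rule injI, rule poly_mapping_eqI)
  fix x y i assume "shift p x = shift p y"
  then have "poly_mapping.lookup (shift p x) (i + p) = poly_mapping.lookup (shift p y) (i + p)"
    by simp
  then show "poly_mapping.lookup x i = poly_mapping.lookup y i"
    by (simp add: shift.rep_eq)
qed

lemma shift_zero [simp]: "shift p 0 = 0"
  using linear_0[OF linear_shift] .

lemma shift_space_R: "x \<in> space_R q \<Longrightarrow> shift p x \<in> space_R (p + q)"
  by (auto simp: space_R_iff shift.rep_eq)

lemma shift_lattice_Z: "x \<in> lattice_Z q \<Longrightarrow> shift p x \<in> lattice_Z (p + q)"
  by (auto simp: lattice_Z_def shift_space_R) (auto simp: shift.rep_eq)

lemma space_R_split:
  assumes "x \<in> space_R (p + q)"
  obtains x1 x2 where "x1 \<in> space_R p" "x2 \<in> space_R q" "x = x1 + shift p x2"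
    "x \<in> lattice_Z (p + q) \<Longrightarrow> x1 \<in> lattice_Z p \<and> x2 \<in> lattice_Z q"
proof -
  define x1 where "x1 = (\<Sum>i<p. poly_mapping.lookup x i *\<^sub>R unit i)"
  define x2 where "x2 = (\<Sum>i<q. poly_mapping.lookup x (i + p) *\<^sub>R unit i)"
  have x1: "poly_mapping.lookup x1 i = (if i < p then poly_mapping.lookup x i else 0)" for i
    by (simp add: x1_def lookup_sum lookup_single when_def if_distrib cong: if_cong)
  have x2: "poly_mapping.lookup x2 i = (if i < q then poly_mapping.lookup x (i + p) else 0)" for i
    by (simp add: x2_def lookup_sum lookup_single when_def if_distrib cong: if_cong)
  have "x = x1 + shift p x2"
    using assms by (intro poly_mapping_eqI) (auto simp: lookup_add shift.rep_eq x1 x2 space_R_iff)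
  moreover have "x1 \<in> space_R p" "x2 \<in> space_R q"
    by (auto simp: space_R_iff x1 x2)
  ultimately show ?thesis
    by (intro that) (auto simp: lattice_Z_def x1 x2)
qed

lemma space_R_split_unique:
  assumes "x1 + shift p x2 = y1 + shift p y2" "x1 \<in> space_R p" "y1 \<in> space_R p"
  shows "x1 = y1" "x2 = y2"
proof -
  have eq: "poly_mapping.lookup (x1 + shift p x2) i = poly_mapping.lookup (y1 + shift p y2) i" for i
    using assms(1) by simp
  show "x1 = y1"
  proof (rule poly_mapping_eqI)
    fix i
    show "poly_mapping.lookup x1 i = poly_mapping.lookup y1 i"
      using eq[of i] assms(2,3) by (cases "i < p") (auto simp: lookup_add shift.rep_eq space_R_iff)
  qed
  then show "x2 = y2"
    using assms(1) inj_shift by (simp add: inj_eq)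
qed

lemma split_lattice_Z_iff:
  assumes "x1 \<in> space_R p" "x2 \<in> space_R q"
  shows "x1 + shift p x2 \<in> lattice_Z (p + q) \<longleftrightarrow> x1 \<in> lattice_Z p \<and> x2 \<in> lattice_Z q"
proof
  assume "x1 + shift p x2 \<in> lattice_Z (p + q)"
  moreover from this obtain y1 y2 where "y1 \<in> space_R p" "x1 + shift p x2 = y1 + shift p y2"
     "x1 + shift p x2 \<in> lattice_Z (p + q) \<Longrightarrow> y1 \<in> lattice_Z p \<and> y2 \<in> lattice_Z q"
    by (meson lattice_Z_subset space_R_split subsetD)
  ultimately show "x1 \<in> lattice_Z p \<and> x2 \<in> lattice_Z q"
    using assms space_R_split_unique[of x1 p x2 y1 y2] by metis
next
  assume "x1 \<in> lattice_Z p \<and> x2 \<in> lattice_Z q"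
  then show "x1 + shift p x2 \<in> lattice_Z (p + q)"
    using lattice_Z_mono[of p "p + q"] by (auto intro!: lattice_Z_add shift_lattice_Z)
qed

lemma split_space_R_mem:
  "x1 \<in> space_R p \<Longrightarrow> x2 \<in> space_R q \<Longrightarrow> x1 + shift p x2 \<in> space_R (p + q)"
  using space_R_mono[of p "p + q"] by (auto intro!: subspace_add[OF subspace_space_R] shift_space_R)

lemma norm_shift [simp]: "norm (shift p x) = norm x"
proof -
  have "Poly_Mapping.keys (shift p x) = (\<lambda>i. i + p) ` Poly_Mapping.keys x"
    by (force simp: in_keys_iff shift.rep_eq intro: image_eqI[of i _ "i - p" for i] split: if_splits)
  then show ?thesis
    by (simp add: norm_poly_mapping_def dist_poly_mapping_def sum.reindex shift.rep_eq)
qed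

lemma continuous_on_shift: "continuous_on S (shift p)"
proof -
  have "bounded_linear (shift p)"
    using linear_shift by (intro bounded_linear_intro[where K = 1]) (auto simp: linear_add linear_scale)
  then show ?thesis
    by (rule linear_continuous_on)
qed

lemma bounded_linear_image:
  assumes "linear f" "K \<subseteq> space_R d" "bounded K"
  shows "bounded (f ` K :: real set)"
proof -
  from \<open>bounded K\<close> obtain B where B: "norm x \<le> B" if "x \<in> K" for x
    by (auto simp: bounded_iff)
  define M where "M = (\<Sum>i<d. \<bar>f (unit i)\<bar>)"
  have "\<bar>f x\<bar> \<le> B * M" if "x \<in> K" for x
  proof -
    have x: "x \<in> space_R d" using that assms by auto
    have lookup_le: "\<bar>poly_mapping.lookup x i\<bar> \<le> B" if "i < d" for i
      using member_le_sum[of i "{..<d}" "\<lambda>i. \<bar>poly_mapping.lookup x i\<bar>"] that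
        norm_space_R[OF x] B[OF \<open>x \<in> K\<close>] by auto
    have "f x = (\<Sum>i<d. poly_mapping.lookup x i *\<^sub>R f (unit i))"
      by (subst space_R_expansion[OF x]) (simp add: linear_sum[OF assms(1)] linear_scale[OF assms(1)])
    also have "\<bar>\<dots>\<bar> \<le> (\<Sum>i<d. \<bar>poly_mapping.lookup x i\<bar> * \<bar>f (unit i)\<bar>)"
      by (rule order_trans[OF sum_abs]) (simp add: abs_mult)
    also have "\<dots> \<le> (\<Sum>i<d. B * \<bar>f (unit i)\<bar>)"
      by (intro sum_mono mult_right_mono lookup_le) auto
    finally show ?thesis
      by (simp add: M_def sum_distrib_left)
  qed
  then show ?thesis
    by (auto simp: bounded_iff intro!: exI[of _ "B * M"])
qed

section \<open>The algebraic interior\<close>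

definition core :: "nat \<Rightarrow> vect set \<Rightarrow> vect set" where
  "core d K = {z \<in> K. \<forall>v\<in>space_R d. \<exists>e>0. z + e *\<^sub>R v \<in> K}"

lemma core_subset: "core d K \<subseteq> K"
  by (auto simp: core_def)

lemma convex_segment_closed:
  fixes K :: "'a::real_vector set"
  assumes "convex K" "z \<in> K" "z + e *\<^sub>R v \<in> K" "0 \<le> e'" "e' \<le> e"
  shows "z + e' *\<^sub>R v \<in> K"
proof (cases "e = 0")
  case False
  have "z + e' *\<^sub>R v = (1 - e'/e) *\<^sub>R z + (e'/e) *\<^sub>R (z + e *\<^sub>R v)"
    using False by (simp add: algebra_simps)
  also have "\<dots> \<in> K"
    using assms False by (intro convexD) (auto simp: field_simps)
  finally show ?thesis .
qed (use assms in auto)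

lemma interior_R_eq_core:
  assumes "K \<subseteq> space_R d" "convex K"
  shows "interior_R d K = core d K"
proof (rule set_eqI, rule iffI)
  fix z assume "z \<in> interior_R d K"
  then obtain T where T: "openin (top_of_set (space_R d)) T" "z \<in> T" "T \<subseteq> K"
    by (auto simp: interior_R_def interior_of_def)
  then obtain r where r: "r > 0" "ball z r \<inter> space_R d \<subseteq> T"
    by (auto simp: openin_contains_ball)
  have "z \<in> space_R d" using T assms by auto
  show "z \<in> core d K"
    unfolding core_def
  proof (intro CollectI conjI ballI)
    show "z \<in> K" using T by auto
    fix v assume "v \<in> space_R d"
    define e where "e = r / (norm v + 1)"
    have pos: "norm v + 1 > 0" using norm_ge_zero[of v] by linarith
    have e: "e > 0" using r pos by (simp add: e_def)
    have "norm (e *\<^sub>R v) = r * (norm v / (norm v + 1))"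
      using r pos by (simp add: e_def abs_of_pos)
    also have "\<dots> < r * 1"
      using r pos by (intro mult_strict_left_mono) (simp_all add: divide_less_eq)
    finally have "z + e *\<^sub>R v \<in> ball z r"
      by (simp add: dist_norm)
    moreover have "z + e *\<^sub>R v \<in> space_R d"
      using \<open>z \<in> space_R d\<close> \<open>v \<in> space_R d\<close> by (intro subspace_add subspace_scale subspace_space_R)
    ultimately show "\<exists>e>0. z + e *\<^sub>R v \<in> K"
      using r T e by (intro exI[of _ e]) auto
  qed
next
  fix z assume z: "z \<in> core d K"
  then have zK: "z \<in> K" and zd: "z \<in> space_R d"
    using assms by (auto simp: core_def)
  have "\<exists>e>0. z + e *\<^sub>R unit i \<in> K \<and> z - e *\<^sub>R unit i \<in> K" if "i < d" for i
  proof -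
    have "\<exists>e>0. z + e *\<^sub>R unit i \<in> K" "\<exists>e>0. z + e *\<^sub>R (- unit i) \<in> K"
      using z unit_space_R[OF that] subspace_neg[OF subspace_space_R, of "unit i" d]
      unfolding core_def by blast+
    then obtain e1 e2 where "e1 > 0" "z + e1 *\<^sub>R unit i \<in> K" "e2 > 0" "z + e2 *\<^sub>R (- unit i) \<in> K"
      by auto
    then show ?thesis
      using convex_segment_closed[OF assms(2) zK, of e1 "unit i" "min e1 e2"]
        convex_segment_closed[OF assms(2) zK, of e2 "- unit i" "min e1 e2"]
      by (intro exI[of _ "min e1 e2"]) auto
  qed
  then obtain e where e: "e i > 0" "z + e i *\<^sub>R unit i \<in> K" "z - e i *\<^sub>R unit i \<in> K" if "i < d" for i
    by metis
  define r where "r = Min (insert 1 (e ` {..<d}))"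
  have r0: "r > 0" unfolding r_def using e by (subst Min_gr_iff) auto
  have re: "r \<le> e i" if "i < d" for i
    unfolding r_def using that by (intro Min_le) auto
  have rK: "z + r *\<^sub>R unit i \<in> K" "z - r *\<^sub>R unit i \<in> K" if "i < d" for i
    using convex_segment_closed[OF assms(2) zK, of "e i" "unit i" r]
      convex_segment_closed[OF assms(2) zK, of "e i" "- unit i" r] e[OF that] re[OF that] r0
    by auto
  have sub: "ball z r \<inter> space_R d \<subseteq> K"
  proof
    fix x assume x: "x \<in> ball z r \<inter> space_R d"
    define y where "y = x - z"
    have y: "y \<in> space_R d" using x zd by (auto simp: y_def intro: subspace_diff[OF subspace_space_R])
    define a where "a i = \<bar>poly_mapping.lookup y i\<bar> / r" for i
    define g where "g i = z + (r * sgn (poly_mapping.lookup y i)) *\<^sub>R unit i" for i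
    define A where "A = (\<Sum>i<d. a i)"
    have "norm y < r" using x by (simp add: y_def dist_norm norm_minus_commute)
    then have A1: "A < 1"
      using r0 norm_space_R[OF y] by (simp add: A_def a_def flip: sum_divide_distrib)
    have gK: "g i \<in> K" if "i < d" for i
      using rK[OF that] zK by (cases "poly_mapping.lookup y i" "0::real" rule: linorder_cases) (auto simp: g_def)
    have "a i *\<^sub>R g i = a i *\<^sub>R z + poly_mapping.lookup y i *\<^sub>R unit i" for i
      using r0 by (simp add: g_def a_def algebra_simps abs_mult_sgn)
    then have "(\<Sum>i<d. a i *\<^sub>R g i) = A *\<^sub>R z + y"
      by (simp add: sum.distrib A_def scaleR_left.sum flip: space_R_expansion[OF y])
    then have "x = (\<Sum>i<Suc d. (if i = d then 1 - A else a i) *\<^sub>R (if i = d then z else g i))"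
      by (simp add: y_def algebra_simps)
    also have "\<dots> \<in> K"
    proof (rule convex_sum[OF _ assms(2)])
      show "(\<Sum>i<Suc d. if i = d then 1 - A else a i) = 1"
        by (simp add: A_def)
    next
      fix i assume "i \<in> {..<Suc d}"
      then show "(if i = d then z else g i) \<in> K"
        using gK[of i] zK by (cases "i = d") auto
    qed (use A1 r0 in \<open>auto simp: a_def\<close>)
    finally show "x \<in> K" .
  qed
  have "openin (top_of_set (space_R d)) (ball z r \<inter> space_R d)"
    by (metis Int_commute open_ball openin_open_Int)
  then show "z \<in> interior_R d K"
    using sub r0 zd unfolding interior_R_def interior_of_def by (intro CollectI exI) auto
qed

section \<open>Direct sums\<close>

lemma not_coreE:
  assumes "z \<notin> core d K"
  obtains v where "v \<in> space_R d" "\<And>e. e > 0 \<Longrightarrow> z + e *\<^sub>R v \<notin> K"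
proof (cases "z \<in> K")
  case True
  then show ?thesis using assms that by (auto simp: core_def)
next
  case False
  then show ?thesis using that[of 0] by auto
qed

definition direct_sum :: "nat \<Rightarrow> vect set \<Rightarrow> vect set \<Rightarrow> vect set" where
  "direct_sum p L K = {(1 - u) *\<^sub>R x + u *\<^sub>R y | x y u. 0 \<le> u \<and> u \<le> 1 \<and> x \<in> L \<and> y \<in> shift p ` K}"

lemma direct_sumI: "x \<in> L \<Longrightarrow> y \<in> K \<Longrightarrow> 0 \<le> u \<Longrightarrow> u \<le> 1 \<Longrightarrow> (1 - u) *\<^sub>R x + u *\<^sub>R shift p y \<in> direct_sum p L K"
  by (auto simp: direct_sum_def)

lemma convex_combine:
  fixes K :: "'a::real_vector set"
  assumes "convex K" "x \<in> K" "y \<in> K" "0 \<le> a" "0 \<le> b"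
  obtains z where "z \<in> K" "a *\<^sub>R x + b *\<^sub>R y = (a + b) *\<^sub>R z"
proof (cases "a + b = 0")
  case True
  with assms have "a = 0" "b = 0" by linarith+
  then show ?thesis using assms by (intro that[of x]) auto
next
  case False
  have "(a / (a + b)) *\<^sub>R x + (b / (a + b)) *\<^sub>R y \<in> K"
    using assms False by (intro convexD) (auto simp flip: add_divide_distrib)
  then show ?thesis
    using False by (intro that[of "(a / (a + b)) *\<^sub>R x + (b / (a + b)) *\<^sub>R y"]) (auto simp: scaleR_add_right)
qed

lemma convex_direct_sum:
  assumes "convex L" "convex K"
  shows "convex (direct_sum p L K)"
proof (rule convexI)
  fix z z' and a b :: real
  assume z: "z \<in> direct_sum p L K" "z' \<in> direct_sum p L K" and ab: "0 \<le> a" "0 \<le> b" "a + b = 1"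
  have K': "convex (shift p ` K)" by (intro convex_linear_image linear_shift assms)
  from z obtain x y u x' y' u' where xy: "x \<in> L" "y \<in> shift p ` K" "0 \<le> u" "u \<le> 1" "z = (1 - u) *\<^sub>R x + u *\<^sub>R y"
    "x' \<in> L" "y' \<in> shift p ` K" "0 \<le> u'" "u' \<le> 1" "z' = (1 - u') *\<^sub>R x' + u' *\<^sub>R y'"
    unfolding direct_sum_def by blast
  obtain x'' where x'': "x'' \<in> L"
    "(a * (1 - u)) *\<^sub>R x + (b * (1 - u')) *\<^sub>R x' = (a * (1 - u) + b * (1 - u')) *\<^sub>R x''"
    using convex_combine[OF assms(1) xy(1,6), of "a * (1 - u)" "b * (1 - u')"] ab xy by auto
  obtain y'' where y'': "y'' \<in> shift p ` K"
    "(a * u) *\<^sub>R y + (b * u') *\<^sub>R y' = (a * u + b * u') *\<^sub>R y''"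
    using convex_combine[OF K' xy(2,7), of "a * u" "b * u'"] ab xy by auto
  have eq: "a * (1 - u) + b * (1 - u') = 1 - (a * u + b * u')"
    using ab by (simp add: algebra_simps)
  have "a * u + b * u' \<le> a * 1 + b * 1"
    using ab xy by (intro add_mono mult_left_mono) auto
  then have le: "a * u + b * u' \<le> 1" using ab by simp
  have ge: "0 \<le> a * u + b * u'"
    using ab xy(3,8) by simp
  have "a *\<^sub>R z + b *\<^sub>R z' = ((a * (1 - u)) *\<^sub>R x + (b * (1 - u')) *\<^sub>R x') + ((a * u) *\<^sub>R y + (b * u') *\<^sub>R y')"
    unfolding xy by (simp add: scaleR_add_right)
  also have "\<dots> = (1 - (a * u + b * u')) *\<^sub>R x'' + (a * u + b * u') *\<^sub>R y''"
    unfolding x''(2) y''(2) eq ..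
  finally show "a *\<^sub>R z + b *\<^sub>R z' \<in> direct_sum p L K"
    unfolding direct_sum_def using x''(1) y''(1) le ge by blast
qed

lemma subset_direct_sum_left: "K \<noteq> {} \<Longrightarrow> L \<subseteq> direct_sum p L K"
  using direct_sumI[of _ L _ K 0 p] by auto

lemma subset_direct_sum_right: "L \<noteq> {} \<Longrightarrow> shift p ` K \<subseteq> direct_sum p L K"
  using direct_sumI[of _ L _ K 1 p] by auto

lemma direct_sum_hull:
  assumes "C \<noteq> {}" "D \<noteq> {}"
  shows "direct_sum p (convex hull C) (convex hull D) = convex hull (C \<union> shift p ` D)"
proof
  show "direct_sum p (convex hull C) (convex hull D) \<subseteq> convex hull (C \<union> shift p ` D)"
  proof
    fix z assume "z \<in> direct_sum p (convex hull C) (convex hull D)"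
    then obtain x y u where "x \<in> convex hull C" "y \<in> convex hull (shift p ` D)" "0 \<le> u" "u \<le> 1"
      "z = (1 - u) *\<^sub>R x + u *\<^sub>R y"
      unfolding direct_sum_def convex_hull_linear_image[OF linear_shift] by blast
    then show "z \<in> convex hull (C \<union> shift p ` D)"
      using hull_mono[of C "C \<union> shift p ` D" convex] hull_mono[of "shift p ` D" "C \<union> shift p ` D" convex]
      by (auto intro!: convexD[OF convex_convex_hull])
  qed
  show "convex hull (C \<union> shift p ` D) \<subseteq> direct_sum p (convex hull C) (convex hull D)"
    using subset_direct_sum_left[of "convex hull D" "convex hull C" p] subset_direct_sum_right[of "convex hull C" p "convex hull D"] assms
      hull_subset[of C convex] hull_subset[of D convex]
    by (intro hull_minimal convex_direct_sum convex_convex_hull) (auto simp: image_subset_iff subset_iff)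
qed

lemma direct_sum_space_R:
  assumes "L \<subseteq> space_R p" "K \<subseteq> space_R q"
  shows "direct_sum p L K \<subseteq> space_R (p + q)"
  using assms space_R_mono[of p "p + q"]
  by (auto simp: direct_sum_def intro!: subspace_add[OF subspace_space_R] subspace_scale[OF subspace_space_R] shift_space_R)

lemma compact_direct_sum: "compact L \<Longrightarrow> compact K \<Longrightarrow> compact (direct_sum p L K)"
  unfolding direct_sum_def
  by (intro compact_convex_combinations compact_continuous_image continuous_on_shift)

lemma scaleR_image_mono:
  fixes K :: "'a::real_vector set"
  assumes "convex K" "0 \<in> K" "0 \<le> a" "a \<le> b" "y \<in> K"
  shows "a *\<^sub>R y \<in> (*\<^sub>R) b ` K"
proof (cases "b = 0")
  case False
  have "(1 - a / b) *\<^sub>R 0 + (a / b) *\<^sub>R y \<in> K"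
    using assms False by (intro convexD) auto
  then show ?thesis
    using False by (intro image_eqI[of _ _ "(a / b) *\<^sub>R y"]) auto
qed (use assms in auto)

lemma core_direct_sum:
  assumes "convex L" "convex K" "u \<in> core p L" "v \<in> core q K"
  shows "(1/2) *\<^sub>R u + (1/2) *\<^sub>R shift p v \<in> core (p + q) (direct_sum p L K)"
  unfolding core_def
proof (intro CollectI conjI ballI)
  have uv: "u \<in> L" "v \<in> K" using assms core_subset by blast+
  show "(1/2) *\<^sub>R u + (1/2) *\<^sub>R shift p v \<in> direct_sum p L K"
    using direct_sumI[OF uv, of "1/2" p] by simp
  fix z assume "z \<in> space_R (p + q)"
  then obtain z1 z2 where z: "z1 \<in> space_R p" "z2 \<in> space_R q" "z = z1 + shift p z2"
    using space_R_split by metis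
  from z assms obtain e1 e2 where e: "e1 > 0" "u + e1 *\<^sub>R z1 \<in> L" "e2 > 0" "v + e2 *\<^sub>R z2 \<in> K"
    unfolding core_def by blast
  define e where "e = min e1 e2"
  have "u + e *\<^sub>R z1 \<in> L" "v + e *\<^sub>R z2 \<in> K"
    using e by (auto simp: e_def intro!: convex_segment_closed[OF assms(1) uv(1), of e1]
        convex_segment_closed[OF assms(2) uv(2), of e2])
  then have "(1 - 1/2) *\<^sub>R (u + e *\<^sub>R z1) + (1/2) *\<^sub>R shift p (v + e *\<^sub>R z2) \<in> direct_sum p L K"
    by (intro direct_sumI) auto
  also have "(1 - 1/2) *\<^sub>R (u + e *\<^sub>R z1) + (1/2) *\<^sub>R shift p (v + e *\<^sub>R z2)
     = ((1/2) *\<^sub>R u + (1/2) *\<^sub>R shift p v) + (e/2) *\<^sub>R z"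
    by (simp add: z linear_add[OF linear_shift] linear_scale[OF linear_shift] algebra_simps)
  finally show "\<exists>e>0. ((1/2) *\<^sub>R u + (1/2) *\<^sub>R shift p v) + e *\<^sub>R z \<in> direct_sum p L K"
    using e by (intro exI[of _ "e/2"]) (auto simp: e_def)
qed

text \<open>\<open>t + K\<close> is hollow, expressed through the algebraic interior.\<close>

definition misses :: "nat \<Rightarrow> vect \<Rightarrow> vect set \<Rightarrow> bool" where
  "misses d t K \<longleftrightarrow> (\<forall>z\<in>core d K. z + t \<notin> lattice_Z d)"

text \<open>If neither component were interior to its summand, moving \<open>z\<close> along two escaping directions
  at once would leave the sum. The factor \<open>b = 0\<close> is allowed on purpose: it covers pyramids.\<close>

lemma misses_direct_sum:
  assumes L: "L \<subseteq> space_R p" "convex L" "0 \<in> L" "misses p t1 ((*\<^sub>R) a ` L)" "t1 \<in> space_R p"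
    and K: "K \<subseteq> space_R q" "convex K" "0 \<in> K" "misses q t2 ((*\<^sub>R) b ` K)" "t2 \<in> space_R q"
    and ab: "0 \<le> a" "0 \<le> b"
  shows "misses (p + q) (t1 + shift p t2) ((*\<^sub>R) (a + b) ` direct_sum p L K)"
  unfolding misses_def
proof (intro ballI notI)
  fix z assume z: "z \<in> core (p + q) ((*\<^sub>R) (a + b) ` direct_sum p L K)"
    and lattice: "z + (t1 + shift p t2) \<in> lattice_Z (p + q)"
  have "z \<in> space_R (p + q)"
    using z core_subset direct_sum_space_R[OF L(1) K(1)] subspace_scale[OF subspace_space_R] by blast
  then obtain z1 z2 where z12: "z1 \<in> space_R p" "z2 \<in> space_R q" "z = z1 + shift p z2"
    using space_R_split by metis
  have "z + (t1 + shift p t2) = (z1 + t1) + shift p (z2 + t2)"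
    by (simp add: z12 linear_add[OF linear_shift])
  with lattice have "(z1 + t1) + shift p (z2 + t2) \<in> lattice_Z (p + q)"
    by (simp only:)
  moreover have "z1 + t1 \<in> space_R p" "z2 + t2 \<in> space_R q"
    using z12 L(5) K(5) by (auto intro: subspace_add[OF subspace_space_R])
  ultimately have "z1 + t1 \<in> lattice_Z p" "z2 + t2 \<in> lattice_Z q"
    using split_lattice_Z_iff by blast+
  then have "z1 \<notin> core p ((*\<^sub>R) a ` L)" "z2 \<notin> core q ((*\<^sub>R) b ` K)"
    using L(4) K(4) by (auto simp: misses_def)
  then obtain v1 v2 where v: "v1 \<in> space_R p" "v2 \<in> space_R q"
    and out: "\<And>e. e > 0 \<Longrightarrow> z1 + e *\<^sub>R v1 \<notin> (*\<^sub>R) a ` L" "\<And>e. e > 0 \<Longrightarrow> z2 + e *\<^sub>R v2 \<notin> (*\<^sub>R) b ` K"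
    by (metis not_coreE)
  obtain e where e: "e > 0" "z + e *\<^sub>R (v1 + shift p v2) \<in> (*\<^sub>R) (a + b) ` direct_sum p L K"
    using z split_space_R_mem[OF v] unfolding core_def by blast
  then obtain x y u where xy: "x \<in> L" "y \<in> K" "0 \<le> u" "u \<le> 1"
    "z + e *\<^sub>R (v1 + shift p v2) = (a + b) *\<^sub>R ((1 - u) *\<^sub>R x + u *\<^sub>R shift p y)"
    unfolding direct_sum_def by blast
  have eq: "(z1 + e *\<^sub>R v1) + shift p (z2 + e *\<^sub>R v2)
      = ((a + b) * (1 - u)) *\<^sub>R x + shift p (((a + b) * u) *\<^sub>R y)"
    using xy(5) by (simp add: z12 linear_add[OF linear_shift] linear_scale[OF linear_shift] algebra_simps)
  have "z1 + e *\<^sub>R v1 \<in> space_R p" "((a + b) * (1 - u)) *\<^sub>R x \<in> space_R p"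
    using v z12 xy L(1) by (auto intro!: subspace_add[OF subspace_space_R] subspace_scale[OF subspace_space_R])
  then have eqs: "z1 + e *\<^sub>R v1 = ((a + b) * (1 - u)) *\<^sub>R x" "z2 + e *\<^sub>R v2 = ((a + b) * u) *\<^sub>R y"
    using space_R_split_unique[OF eq] by auto
  have "(a + b) * (1 - u) + (a + b) * u = a + b"
    by (simp add: algebra_simps)
  then consider "(a + b) * (1 - u) \<le> a" | "(a + b) * u \<le> b" by linarith
  then show False
  proof cases
    case 1
    then have "((a + b) * (1 - u)) *\<^sub>R x \<in> (*\<^sub>R) a ` L"
      using L xy ab by (intro scaleR_image_mono) auto
    then show False using out(1)[OF e(1)] eqs by simp
  next
    case 2
    then have "((a + b) * u) *\<^sub>R y \<in> (*\<^sub>R) b ` K"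
      using K xy ab by (intro scaleR_image_mono) auto
    then show False using out(2)[OF e(1)] eqs by simp
  qed
qed

section \<open>Lattice width\<close>

definition wide :: "nat \<Rightarrow> real \<Rightarrow> vect set \<Rightarrow> bool" where
  "wide d c K \<longleftrightarrow> (\<forall>f\<in>nonzero_dual d. \<exists>x\<in>K. \<exists>y\<in>K. c \<le> f x - f y)"

lemma wide_direct_sum:
  assumes "wide p c L" "wide q c K" "0 \<in> L" "0 \<in> K"
  shows "wide (p + q) c (direct_sum p L K)"
  unfolding wide_def
proof
  fix f assume "f \<in> nonzero_dual (p + q)"
  then have f: "linear f" and int: "\<And>x. x \<in> lattice_Z (p + q) \<Longrightarrow> f x \<in> \<int>"
    and nz: "\<exists>x\<in>lattice_Z (p + q). f x \<noteq> 0"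
    by (auto simp: nonzero_dual_def)
  have sub: "L \<subseteq> direct_sum p L K" "shift p ` K \<subseteq> direct_sum p L K"
    using assms(3,4) by (auto intro!: subset_direct_sum_left subset_direct_sum_right)
  show "\<exists>x\<in>direct_sum p L K. \<exists>y\<in>direct_sum p L K. c \<le> f x - f y"
  proof (cases "\<exists>x\<in>lattice_Z p. f x \<noteq> 0")
    case True
    then have "f \<in> nonzero_dual p"
      using f int lattice_Z_mono[of p "p + q"] by (auto simp: nonzero_dual_def)
    then show ?thesis
      using assms(1) sub unfolding wide_def by blast
  next
    case False
    from nz obtain x where x: "x \<in> lattice_Z (p + q)" "f x \<noteq> 0" by blast
    then obtain x1 x2 where x12: "x1 \<in> lattice_Z p" "x2 \<in> lattice_Z q" "x = x1 + shift p x2"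
      by (meson lattice_Z_subset space_R_split subsetD)
    then have "f (shift p x2) \<noteq> 0"
      using x False by (auto simp: linear_add[OF f])
    then have "f \<circ> shift p \<in> nonzero_dual q"
      using x12 int by (auto simp: nonzero_dual_def shift_lattice_Z intro!: linear_compose linear_shift f)
    then obtain y y' where "y \<in> K" "y' \<in> K" "c \<le> f (shift p y) - f (shift p y')"
      using assms(2) unfolding wide_def by force
    then show ?thesis
      using sub by blast
  qed
qed

lemma wide_scale:
  assumes "wide d c K" "0 \<le> a"
  shows "wide d (a * c) ((*\<^sub>R) a ` K)"
  unfolding wide_def
proof
  fix f assume f: "f \<in> nonzero_dual d"
  then obtain x y where xy: "x \<in> K" "y \<in> K" "c \<le> f x - f y"
    using assms by (auto simp: wide_def)
  have "linear f" using f by (simp add: nonzero_dual_def)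
  then have "a * c \<le> f (a *\<^sub>R x) - f (a *\<^sub>R y)"
    using mult_left_mono[OF xy(3) assms(2)] by (simp add: linear_scale right_diff_distrib)
  then show "\<exists>x\<in>(*\<^sub>R) a ` K. \<exists>y\<in>(*\<^sub>R) a ` K. a * c \<le> f x - f y"
    using xy by blast
qed

lemma wide_translation [simp]: "wide d c ((+) t ` K) \<longleftrightarrow> wide d c K"
  by (auto simp: wide_def nonzero_dual_def linear_add intro!: ball_cong)

lemma linear_on_space_R_1:
  assumes "linear f" "x \<in> space_R 1"
  shows "f x = poly_mapping.lookup x 0 * f (unit 0)"
proof -
  have "f x = f (poly_mapping.lookup x 0 *\<^sub>R unit 0)"
    using space_R_expansion[OF assms(2)] by simp
  then show ?thesis
    by (simp add: linear_scale[OF assms(1)])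
qed

lemma wide_segment: "wide 1 (real n) (convex hull {0, real n *\<^sub>R unit 0})"
  unfolding wide_def
proof
  fix f assume "f \<in> nonzero_dual 1"
  then have f: "linear f" "f (unit 0) \<in> \<int>" and "\<exists>x\<in>lattice_Z 1. f x \<noteq> 0"
    using unit_lattice_Z[of 0 1] by (auto simp: nonzero_dual_def)
  then have "f (unit 0) \<noteq> 0"
    using linear_on_space_R_1[OF f(1)] lattice_Z_subset by fastforce
  then have "real n * 1 \<le> real n * \<bar>f (unit 0)\<bar>"
    using f by (intro mult_left_mono Ints_nonzero_abs_ge1) auto
  also have "\<dots> = \<bar>f (real n *\<^sub>R unit 0) - f 0\<bar>"
    by (simp add: linear_scale[OF f(1)] linear_0[OF f(1)] abs_mult)
  finally have *: "real n \<le> f (real n *\<^sub>R unit 0) - f 0 \<or> real n \<le> f 0 - f (real n *\<^sub>R unit 0)"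
    by linarith
  have "0 \<in> convex hull {0, real n *\<^sub>R unit 0}" "real n *\<^sub>R unit 0 \<in> convex hull {0, real n *\<^sub>R unit 0}"
    by (auto intro: hull_inc)
  with * show "\<exists>x\<in>convex hull {0, real n *\<^sub>R unit 0}. \<exists>y\<in>convex hull {0, real n *\<^sub>R unit 0}. real n \<le> f x - f y"
    by blast
qed

lemma wide_if_less_lattice_width:
  assumes "c < lattice_width d K" "K \<subseteq> space_R d" "bounded K" "K \<noteq> {}"
  shows "wide d c K"
  unfolding wide_def
proof
  fix f assume f: "f \<in> nonzero_dual d"
  have bdd: "bdd_above (g ` K)" "bdd_below (g ` K)" if "g \<in> nonzero_dual d" for g
    using bounded_linear_image[of g K d] that assms bounded_imp_bdd_above bounded_imp_bdd_below
    by (auto simp: nonzero_dual_def)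
  have "(INF x\<in>K. g x) \<le> (SUP x\<in>K. g x)" if "g \<in> nonzero_dual d" for g
    using bdd[OF that] assms(4) by (meson cINF_lower cSUP_upper all_not_in_conv order_trans)
  then have "bdd_below ((\<lambda>f. (SUP x\<in>K. f x) - (INF x\<in>K. f x)) ` nonzero_dual d)"
    by (intro bdd_belowI2[of _ 0]) auto
  then have "lattice_width d K \<le> (SUP x\<in>K. f x) - (INF x\<in>K. f x)"
    unfolding lattice_width_def using f by (rule cINF_lower)
  with assms(1) have "c + (INF x\<in>K. f x) < (SUP x\<in>K. f x)" by linarith
  then obtain x where x: "x \<in> K" "c + (INF x\<in>K. f x) < f x"
    using bdd[OF f] assms(4) by (auto simp: less_cSUP_iff)
  then have "(INF x\<in>K. f x) < f x - c" by linarith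
  then obtain y where "y \<in> K" "f y < f x - c"
    using bdd[OF f] assms(4) by (auto simp: cINF_less_iff)
  then show "\<exists>x\<in>K. \<exists>y\<in>K. c \<le> f x - f y"
    using x by (intro bexI[of _ x] bexI[of _ y]) auto
qed

lemma le_lattice_width:
  assumes "wide d c K" "K \<subseteq> space_R d" "bounded K" "d \<ge> 1"
  shows "c \<le> lattice_width d K"
  unfolding lattice_width_def
proof (rule cINF_greatest)
  have "(\<lambda>x. poly_mapping.lookup x 0) \<in> nonzero_dual d"
    using linear_lookup[of 0] unit_lattice_Z[of 0 d] assms(4)
    by (auto simp: nonzero_dual_def lattice_Z_def intro!: bexI[of _ "unit 0"])
  then show "nonzero_dual d \<noteq> {}" by blast
next
  fix f assume f: "f \<in> nonzero_dual d"
  then obtain x y where xy: "x \<in> K" "y \<in> K" "c \<le> f x - f y"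
    using assms(1) by (auto simp: wide_def)
  have "bdd_above (f ` K)" "bdd_below (f ` K)"
    using bounded_linear_image[of f K d] f assms bounded_imp_bdd_above bounded_imp_bdd_below
    by (auto simp: nonzero_dual_def)
  then have "f x \<le> (SUP x\<in>K. f x)" "(INF x\<in>K. f x) \<le> f y"
    using xy by (auto intro: cSUP_upper cINF_lower)
  then show "c \<le> (SUP x\<in>K. f x) - (INF x\<in>K. f x)"
    using xy(3) by linarith
qed

section \<open>Families of bodies closed under direct sums\<close>

locale body_family =
  fixes P :: "nat \<Rightarrow> vect set \<Rightarrow> bool" and T :: "nat \<Rightarrow> vect set" and w :: "nat \<Rightarrow> ereal"
  assumes P_body: "P d K \<Longrightarrow> K \<subseteq> space_R d \<and> convex K \<and> bounded K \<and> 0 \<in> K"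
    and P_direct_sum: "P p L \<Longrightarrow> P q K \<Longrightarrow> P (p + q) (direct_sum p L K)"
    and P_scale: "P d K \<Longrightarrow> n \<ge> 1 \<Longrightarrow> P d ((*\<^sub>R) (real n) ` K)"
    and P_segment: "n \<ge> 1 \<Longrightarrow> P 1 (convex hull {0, real n *\<^sub>R unit 0})"
    and T_space: "T d \<subseteq> space_R d"
    and T_zero: "0 \<in> T d"
    and T_shift: "t1 \<in> T p \<Longrightarrow> t2 \<in> T q \<Longrightarrow> t1 + shift p t2 \<in> T (p + q)"
    and w_upper: "P d K \<Longrightarrow> t \<in> T d \<Longrightarrow> misses d t K \<Longrightarrow> ereal (lattice_width d ((+) t ` K)) \<le> w d"
    and w_less: "ereal c < w d \<Longrightarrow> \<exists>K t. P d K \<and> t \<in> T d \<and> misses d t K \<and> c < lattice_width d ((+) t ` K)"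
begin

lemma multiple:
  assumes "ereal c < w d" "m \<ge> 1"
  shows "\<exists>L t. P (m * d) L \<and> t \<in> T (m * d) \<and> misses (m * d) t ((*\<^sub>R) (real m) ` L) \<and> wide (m * d) c L"
proof -
  obtain K t where K: "P d K" "t \<in> T d" "misses d t K" "c < lattice_width d ((+) t ` K)"
    using w_less[OF assms(1)] by blast
  have body: "K \<subseteq> space_R d" "convex K" "bounded K" "0 \<in> K" "t \<in> space_R d"
    using P_body[OF K(1)] K(2) T_space by auto
  have "wide d c ((+) t ` K)"
    using body by (intro wide_if_less_lattice_width K bounded_translation)
      (auto intro!: subspace_add[OF subspace_space_R])
  then have wide: "wide d c K" by simp
  show ?thesis
    using assms(2)
  proof (induction m rule: dec_induct)
    case base
    then show ?case using K wide by auto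
  next
    case (step m)
    then obtain L s where L: "P (m * d) L" "s \<in> T (m * d)"
       "misses (m * d) s ((*\<^sub>R) (real m) ` L)" "wide (m * d) c L"
      by blast
    have "misses (d + m * d) (t + shift d s) ((*\<^sub>R) (1 + real m) ` direct_sum d K L)"
      using P_body[OF L(1)] L(2,3) T_space body K(3) by (intro misses_direct_sum) auto
    moreover have "wide (d + m * d) c (direct_sum d K L)"
      using wide_direct_sum[OF wide L(4)] P_body[OF L(1)] body by auto
    ultimately show ?case
      using P_direct_sum[OF K(1) L(1)] T_shift[OF K(2) L(2)] by (auto simp: add.commute)
  qed
qed

lemma pyramid:
  assumes "P d K" "t \<in> T d" "misses d t K" "wide d c K"
  shows "\<exists>L s. P (d + r) L \<and> s \<in> T (d + r) \<and> misses (d + r) s L \<and> wide (d + r) c L"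
proof (induction r)
  case 0
  then show ?case using assms by auto
next
  case (Suc r)
  then obtain L s where L: "P (d + r) L" "s \<in> T (d + r)" "misses (d + r) s L" "wide (d + r) c L"
    by blast
  define n where "n = max 1 (nat \<lceil>c\<rceil>)"
  define I where "I = convex hull {0, real n *\<^sub>R unit 0}"
  have "P 1 I" using P_segment[of n] by (simp add: I_def n_def)
  then have I: "I \<subseteq> space_R 1" "convex I" "0 \<in> I" using P_body by auto
  have "core 1 {0} = {}"
  proof (rule equals0I)
    fix z assume "z \<in> core 1 {0}"
    then have z: "z = 0" "\<And>v. v \<in> space_R 1 \<Longrightarrow> \<exists>e>0. z + e *\<^sub>R v \<in> {0}"
      by (auto simp: core_def)
    obtain e where "e > 0" "z + e *\<^sub>R unit 0 \<in> {0}"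
      using z(2)[OF unit_space_R] by (metis zero_less_one)
    with z(1) show False by simp
  qed
  moreover have "(*\<^sub>R) 0 ` I = {0}" using I by auto
  ultimately have "misses 1 0 ((*\<^sub>R) 0 ` I)" by (simp add: misses_def)
  then have "misses (d + r + 1) (s + shift (d + r) 0) ((*\<^sub>R) (1 + 0) ` direct_sum (d + r) L I)"
    using P_body[OF L(1)] L T_space I by (intro misses_direct_sum) auto
  moreover have "c \<le> real n" unfolding n_def by linarith
  then have "wide 1 c I"
    using wide_segment[of n] unfolding I_def wide_def by (meson order_trans)
  then have "wide (d + r + 1) c (direct_sum (d + r) L I)"
    using wide_direct_sum[OF L(4), of 1 I] P_body[OF L(1)] I by blast
  ultimately show ?case
    using P_direct_sum[OF L(1) \<open>P 1 I\<close>] T_shift[OF L(2) T_zero[of 1]]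
    by (intro exI[of _ "direct_sum (d + r) L I"] exI[of _ s]) auto
qed

lemma w_multiple_add:
  assumes "ereal c < w d" "m \<ge> 1" "d \<ge> 1"
  shows "ereal (real m * c) \<le> w (m * d + r)"
proof -
  obtain L t where L: "P (m * d) L" "t \<in> T (m * d)" "misses (m * d) t ((*\<^sub>R) (real m) ` L)" "wide (m * d) c L"
    using multiple[OF assms(1,2)] by blast
  obtain K s where K: "P (m * d + r) K" "s \<in> T (m * d + r)" "misses (m * d + r) s K"
    "wide (m * d + r) (real m * c) K"
    using pyramid[OF P_scale[OF L(1) assms(2)] L(2,3) wide_scale[OF L(4)], of r] by auto
  have "1 \<le> m * d + r"
    using assms(2,3) by (simp add: Suc_le_eq)
  then have "real m * c \<le> lattice_width (m * d + r) ((+) s ` K)"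
    using P_body[OF K(1)] K(2,4) T_space
    by (intro le_lattice_width bounded_translation) (auto intro!: subspace_add[OF subspace_space_R])
  then show ?thesis
    using w_upper[OF K(1,2,3)] by (meson ereal_less_eq(3) order_trans)
qed

theorem limit: "(\<lambda>d. w d / ereal (real d)) \<longlonglongrightarrow> (SUP d\<in>{1..}. w d / ereal (real d))"
proof (rule order_tendstoI)
  fix a assume "a < (SUP d\<in>{1..}. w d / ereal (real d))"
  then obtain d where d: "d \<ge> 1" "a < w d / ereal (real d)"
    by (auto simp: less_SUP_iff)
  obtain b where b: "a < ereal b" "ereal b < w d / ereal (real d)"
    using ereal_dense2[OF d(2)] by blast
  obtain b' where b': "ereal b < ereal b'" "ereal b' < w d / ereal (real d)"
    using ereal_dense2[OF b(2)] by blast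
  define c where "c = b' * real d"
  have "ereal c < w d"
    using b'(2) d(1) by (simp add: c_def ereal_less_divide_pos mult.commute)
  have "b < b'" using b' by simp
  have lim: "(\<lambda>n. real (n div d) * c / real n) \<longlonglongrightarrow> b'"
  proof (rule LIM_zero_cancel, rule Lim_null_comparison)
    have "(\<lambda>n. \<bar>c\<bar> * (1 / real n)) \<longlonglongrightarrow> \<bar>c\<bar> * 0"
      by (intro tendsto_intros lim_1_over_n)
    then show "(\<lambda>n. \<bar>c\<bar> / real n) \<longlonglongrightarrow> 0" by simp
    show "\<forall>\<^sub>F n in sequentially. norm (real (n div d) * c / real n - b') \<le> \<bar>c\<bar> / real n"
      using eventually_gt_at_top[of 0]
    proof eventually_elim
      case (elim n)
      have "real (n div d) * c / real n - b' = c * (real (n div d) - real n / real d) / real n"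
        using elim d(1) by (simp add: c_def field_simps)
      also have "\<bar>\<dots>\<bar> \<le> \<bar>c\<bar> * 1 / real n"
        unfolding abs_divide abs_mult
        using floor_divide_of_nat_eq[of n d, where ?'a = real] floor_correct[of "real n / real d"]
        by (intro frac_le mult_left_mono) (use elim in \<open>auto simp: abs_le_iff\<close>)
      finally show ?case by simp
    qed
  qed
  have "\<forall>\<^sub>F n in sequentially. b < real (n div d) * c / real n"
    using order_tendstoD(1)[OF lim \<open>b < b'\<close>] .
  then show "\<forall>\<^sub>F n in sequentially. a < w n / ereal (real n)"
    using eventually_ge_at_top[of d]
  proof eventually_elim
    case (elim n)
    have "n div d \<ge> 1" using elim d(1) by (simp add: div_greater_zero_iff Suc_leI)
    then have "ereal (real (n div d) * c) \<le> w n"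
      using w_multiple_add[OF \<open>ereal c < w d\<close> _ d(1), of "n div d" "n mod d"] by simp
    then have "ereal (real (n div d) * c) / ereal (real n) \<le> w n / ereal (real n)"
      by (intro ereal_divide_right_mono) (use elim d in auto)
    moreover have "ereal b < ereal (real (n div d) * c) / ereal (real n)"
      using elim d(1) by auto
    ultimately show ?case
      using b(1) by (meson order.strict_trans order.strict_trans2)
  qed
next
  fix a assume a: "(SUP d\<in>{1..}. w d / ereal (real d)) < a"
  show "\<forall>\<^sub>F d in sequentially. w d / ereal (real d) < a"
    using eventually_ge_at_top[of 1]
  proof eventually_elim
    case (elim d)
    then show ?case
      using SUP_upper[of d "{1..}" "\<lambda>d. w d / ereal (real d)"] a by (meson atLeast_iff le_less_trans)
  qed
qed

end

section \<open>Convex bodies\<close>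

lemma core_translation: "core d ((+) t ` K) = (+) t ` core d K"
proof -
  have "t + x + y \<in> (+) t ` K \<longleftrightarrow> x + y \<in> K" for x y
    by (auto simp: add.assoc)
  then show ?thesis
    by (auto simp: core_def)
qed

lemma hollow_translation_iff:
  assumes "K \<subseteq> space_R d" "convex K" "t \<in> space_R d"
  shows "hollow d ((+) t ` K) \<longleftrightarrow> misses d t K"
proof -
  have "interior_R d ((+) t ` K) = (+) t ` core d K"
    using assms unfolding core_translation[symmetric]
    by (intro interior_R_eq_core) (auto intro!: subspace_add[OF subspace_space_R])
  then show ?thesis
    by (auto simp: hollow_def misses_def add.commute)
qed

definition pointed_body :: "nat \<Rightarrow> vect set \<Rightarrow> bool" where
  "pointed_body d K \<longleftrightarrow> K \<subseteq> space_R d \<and> convex K \<and> compact K \<and> 0 \<in> K \<and> core d K \<noteq> {}"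

lemma pointed_body_direct_sum:
  assumes "pointed_body p L" "pointed_body q K"
  shows "pointed_body (p + q) (direct_sum p L K)"
proof -
  have "core (p + q) (direct_sum p L K) \<noteq> {}"
    using assms core_direct_sum[of L K _ p _ q] unfolding pointed_body_def by blast
  moreover have "L \<subseteq> direct_sum p L K"
    using assms by (intro subset_direct_sum_left) (auto simp: pointed_body_def)
  ultimately show ?thesis
    using assms by (auto simp: pointed_body_def direct_sum_space_R[THEN subsetD] convex_direct_sum compact_direct_sum)
qed

lemma pointed_body_scale:
  assumes "pointed_body d K" "r > 0"
  shows "pointed_body d ((*\<^sub>R) r ` K)"
proof -
  obtain z where z: "z \<in> core d K" using assms by (auto simp: pointed_body_def)
  have "r *\<^sub>R z \<in> core d ((*\<^sub>R) r ` K)"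
    unfolding core_def
  proof (intro CollectI conjI ballI)
    show "r *\<^sub>R z \<in> (*\<^sub>R) r ` K" using z core_subset by blast
    fix v assume "v \<in> space_R d"
    then obtain e where e: "e > 0" "z + e *\<^sub>R v \<in> K" using z by (auto simp: core_def)
    then have "r *\<^sub>R (z + e *\<^sub>R v) \<in> (*\<^sub>R) r ` K" by blast
    then show "\<exists>e>0. r *\<^sub>R z + e *\<^sub>R v \<in> (*\<^sub>R) r ` K"
      using e assms(2) by (intro exI[of _ "r * e"]) (auto simp: scaleR_add_right)
  qed
  moreover have "0 \<in> (*\<^sub>R) r ` K"
    using assms by (force simp: pointed_body_def)
  ultimately show ?thesis
    using assms by (auto simp: pointed_body_def convex_scaling compact_scaling intro!: subspace_scale[OF subspace_space_R])
qed

lemma pointed_body_segment: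
  assumes "n \<ge> 1"
  shows "pointed_body 1 (convex hull {0, real n *\<^sub>R unit 0})"
proof -
  let ?I = "convex hull {0, real n *\<^sub>R unit 0}"
  have unit: "unit 0 \<in> space_R 1" by (rule unit_space_R) simp
  have mem: "r *\<^sub>R unit 0 \<in> ?I" if "0 \<le> r" "r \<le> real n" for r
    using assms that unfolding convex_hull_2
    by (intro CollectI exI[of _ "1 - r / real n"] exI[of _ "r / real n"]) auto
  have "(real n / 2) *\<^sub>R unit 0 \<in> core 1 ?I"
    unfolding core_def
  proof (intro CollectI conjI ballI)
    show "(real n / 2) *\<^sub>R unit 0 \<in> ?I" by (rule mem) auto
    fix v assume "v \<in> space_R 1"
    then have v: "v = poly_mapping.lookup v 0 *\<^sub>R unit 0"
      using space_R_expansion[of v 1] by simp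
    define a where "a = poly_mapping.lookup v 0"
    define b where "b = \<bar>a\<bar> + 1"
    define e where "e = real n / 2 / b"
    have b: "b > 0" by (simp add: b_def)
    have e: "e > 0" using assms b by (simp add: e_def)
    have "e * \<bar>a\<bar> \<le> e * b" using e by (simp add: b_def)
    also have "\<dots> = real n / 2" using b by (simp add: e_def)
    finally have "\<bar>e * a\<bar> \<le> real n / 2" using e by (simp add: abs_mult)
    then have "(real n / 2 + e * a) *\<^sub>R unit 0 \<in> ?I"
      unfolding abs_le_iff by (intro mem) linarith+
    also have "(real n / 2 + e * a) *\<^sub>R unit 0 = (real n / 2) *\<^sub>R unit 0 + e *\<^sub>R v"
      by (subst v) (simp only: a_def scaleR_add_left scaleR_scaleR)
    finally show "\<exists>e>0. (real n / 2) *\<^sub>R unit 0 + e *\<^sub>R v \<in> ?I"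
      using e by blast
  qed
  moreover have "?I \<subseteq> space_R 1"
    using subspace_scale[OF subspace_space_R unit]
    by (intro hull_minimal subspace_imp_convex subspace_space_R) auto
  ultimately show ?thesis
    by (auto simp: pointed_body_def hull_inc finite_imp_compact_convex_hull)
qed

lemma body_family_convex: "body_family pointed_body space_R w_c"
proof
  fix d K assume "pointed_body d K"
  then show "K \<subseteq> space_R d \<and> convex K \<and> bounded K \<and> 0 \<in> K"
    by (auto simp: pointed_body_def compact_imp_bounded)
next
  fix d K t assume K: "pointed_body d K" "t \<in> space_R d" "misses d t K"
  then have "hollow d ((+) t ` K)"
    by (subst hollow_translation_iff) (auto simp: pointed_body_def)
  moreover have sub: "(+) t ` K \<subseteq> space_R d"
    using K by (auto simp: pointed_body_def intro!: subspace_add[OF subspace_space_R])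
  moreover have "interior_R d ((+) t ` K) \<noteq> {}"
    using K sub by (subst interior_R_eq_core) (auto simp: pointed_body_def core_translation)
  ultimately have "convex_body d ((+) t ` K) \<and> hollow d ((+) t ` K)"
    using K by (auto simp: convex_body_def pointed_body_def intro!: compact_translation)
  then show "ereal (lattice_width d ((+) t ` K)) \<le> w_c d"
    unfolding w_c_def by (intro SUP_upper) auto
next
  fix c d assume "ereal c < w_c d"
  then obtain K where K: "convex_body d K" "hollow d K" "c < lattice_width d K"
    by (auto simp: w_c_def less_SUP_iff)
  then have body: "K \<subseteq> space_R d" "convex K" "compact K" "core d K \<noteq> {}"
    using interior_R_eq_core[of K d] by (auto simp: convex_body_def)
  then obtain t where t: "t \<in> K" using core_subset by blast
  define L where "L = (+) (- t) ` K"
  have K_eq: "(+) t ` L = K" by (simp add: L_def image_image)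
  have "t \<in> space_R d" using t body by auto
  then have "L \<subseteq> space_R d"
    using body by (auto simp: L_def intro!: subspace_diff[OF subspace_space_R])
  moreover have "0 \<in> L" using t by (force simp: L_def)
  moreover have "compact L" "convex L" "core d L \<noteq> {}"
    unfolding L_def core_translation using body by (simp_all only: compact_translation convex_translation image_is_empty not_False_eq_True)
  ultimately have "pointed_body d L"
    by (simp add: pointed_body_def)
  moreover have "misses d t L"
    using hollow_translation_iff[of L d t] K(2) K_eq \<open>t \<in> space_R d\<close> \<open>pointed_body d L\<close>
    by (auto simp: pointed_body_def)
  ultimately show "\<exists>K t. pointed_body d K \<and> t \<in> space_R d \<and> misses d t K \<and> c < lattice_width d ((+) t ` K)"
    using K(3) K_eq \<open>t \<in> space_R d\<close> by (intro exI[of _ L] exI[of _ t]) auto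
qed (use pointed_body_segment in \<open>auto intro: pointed_body_direct_sum pointed_body_scale split_space_R_mem simp del: single_one\<close>)

section \<open>Lattice polytopes and lattice simplices\<close>

lemma irredundant_generators:
  fixes C :: "'a::real_vector set"
  assumes "finite C"
  shows "\<exists>C'\<subseteq>C. convex hull C' = convex hull C \<and> (\<forall>c\<in>C'. c \<notin> convex hull (C' - {c}))"
  using assms
proof (induction C rule: finite_psubset_induct)
  case (psubset C)
  show ?case
  proof (cases "\<forall>c\<in>C. c \<notin> convex hull (C - {c})")
    case False
    then obtain c where c: "c \<in> C" "c \<in> convex hull (C - {c})" by blast
    then have "convex hull (C - {c}) = convex hull C"
      using hull_redundant[of c convex "C - {c}"] by (simp add: insert_absorb)
    moreover have "C - {c} \<subset> C" using c by blast
    ultimately show ?thesis using psubset.IH[of "C - {c}"] by (metis Diff_subset order_trans)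
  qed auto
qed

lemma generators_are_extreme_points:
  fixes C :: "'a::real_vector set"
  assumes "finite C" "c \<in> C" "c \<notin> convex hull (C - {c})"
  shows "c extreme_point_of convex hull C"
  using extreme_point_of_convex_hull_insert[of "C - {c}" c] assms by (simp add: insert_absorb)

lemma independent_units: "independent (unit ` {..<d})"
proof
  assume "dependent (unit ` {..<d})"
  then obtain i where "unit i \<in> span (unit ` {..<d} - {unit i})"
    by (auto simp: dependent_def)
  moreover have "span (unit ` {..<d} - {unit i}) \<subseteq> {x. poly_mapping.lookup x i = 0}"
    by (rule span_minimal) (auto simp: subspace_def lookup_add lookup_single when_def)
  ultimately show False by (auto simp: lookup_single)
qed

lemma independent_if_card_eq:
  assumes "finite B" "span B = space_R d" "card B = d"
  shows "independent B"
proof -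
  obtain B' where B': "B' \<subseteq> B" "independent B'" "B \<subseteq> span B'"
    using maximal_independent_subset by blast
  have "span B' = space_R d"
    using B' assms(2) by (metis span_mono span_minimal subspace_span subset_antisym)
  then have "unit ` {..<d} \<subseteq> span B'"
    using unit_space_R by auto
  then have "card (unit ` {..<d}) \<le> card B'"
    using independent_span_bound[OF _ independent_units] B' assms(1) finite_subset by blast
  moreover have "inj_on unit {..<d}"
    by (rule inj_onI) (metis lookup_single_eq lookup_single_not_eq zero_neq_one)
  ultimately have "card B \<le> card B'"
    using assms by (simp add: card_image)
  then have "B' = B"
    using B'(1) assms(1) card_seteq by blast
  then show ?thesis using B'(2) by simp
qed

text \<open>The flag \<open>s\<close> selects simplices among the lattice polytopes.\<close>

definition pointed_lattice_set :: "bool \<Rightarrow> nat \<Rightarrow> vect set \<Rightarrow> bool" where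
  "pointed_lattice_set s d C \<longleftrightarrow>
     finite C \<and> C \<subseteq> lattice_Z d \<and> 0 \<in> C \<and> span C = space_R d \<and> (s \<longrightarrow> card C = Suc d)"

definition pointed_polytope :: "bool \<Rightarrow> nat \<Rightarrow> vect set \<Rightarrow> bool" where
  "pointed_polytope s d K \<longleftrightarrow> (\<exists>C. pointed_lattice_set s d C \<and> K = convex hull C)"

lemma pointed_lattice_set_Un:
  assumes "pointed_lattice_set s p C" "pointed_lattice_set s q D"
  shows "pointed_lattice_set s (p + q) (C \<union> shift p ` D)"
proof -
  have C: "finite C" "C \<subseteq> lattice_Z p" "0 \<in> C" "span C = space_R p" "s \<Longrightarrow> card C = Suc p"
    and D: "finite D" "D \<subseteq> lattice_Z q" "0 \<in> D" "span D = space_R q" "s \<Longrightarrow> card D = Suc q"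
    using assms by (auto simp: pointed_lattice_set_def)
  have lattice: "C \<union> shift p ` D \<subseteq> lattice_Z (p + q)"
    using C(2) D(2) lattice_Z_mono[of p "p + q"] by (auto intro!: shift_lattice_Z)
  have "span (C \<union> shift p ` D) = space_R (p + q)"
  proof
    show "span (C \<union> shift p ` D) \<subseteq> space_R (p + q)"
      using lattice lattice_Z_subset by (intro span_minimal subspace_space_R) blast
    show "space_R (p + q) \<subseteq> span (C \<union> shift p ` D)"
    proof
      fix x assume "x \<in> space_R (p + q)"
      then obtain x1 x2 where x: "x1 \<in> span C" "x2 \<in> span D" "x = x1 + shift p x2"
        using C(4) D(4) by (metis space_R_split)
      have "shift p x2 \<in> span (shift p ` D)"
        using x(2) linear_span_image[OF linear_shift, of p D] by blast
      then show "x \<in> span (C \<union> shift p ` D)"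
        using x span_mono[of C "C \<union> shift p ` D"] span_mono[of "shift p ` D" "C \<union> shift p ` D"]
        by (auto intro!: span_add)
    qed
  qed
  moreover have "card (C \<union> shift p ` D) = Suc (p + q)" if s
  proof -
    have "x = 0" if "x \<in> C" "x = shift p y" for x y
      using space_R_split_unique(1)[of x p 0 0 y] that C(2) lattice_Z_subset by auto
    moreover have "0 \<in> C \<inter> shift p ` D"
      using C(3) D(3) shift_zero by (metis IntI imageI)
    ultimately have "C \<inter> shift p ` D = {0}"
      by blast
    moreover have "card (shift p ` D) = card D"
      by (meson card_image inj_on_subset inj_shift subset_UNIV)
    ultimately show ?thesis
      using card_Un_Int[of C "shift p ` D"] C D that by simp
  qed
  ultimately show ?thesis
    using C D lattice by (auto simp: pointed_lattice_set_def)
qed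

lemma pointed_lattice_set_scale:
  assumes "pointed_lattice_set s d C" "n \<ge> 1"
  shows "pointed_lattice_set s d ((*\<^sub>R) (real n) ` C)"
proof -
  have "span ((*\<^sub>R) (real n) ` C) = span C"
    using span_image_scale[of C "\<lambda>_. real n"] assms by (simp add: pointed_lattice_set_def)
  moreover have "card ((*\<^sub>R) (real n) ` C) = card C"
    using assms by (intro card_image) (auto simp: inj_on_def)
  moreover have "0 \<in> (*\<^sub>R) (real n) ` C"
    using assms by (force simp: pointed_lattice_set_def)
  ultimately show ?thesis
    using assms by (auto simp: pointed_lattice_set_def lattice_Z_scale)
qed

lemma pointed_lattice_set_segment:
  assumes "n \<ge> 1"
  shows "pointed_lattice_set s 1 {0, real n *\<^sub>R unit 0}"
proof -
  have lattice: "real n *\<^sub>R unit 0 \<in> lattice_Z 1"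
    by (intro lattice_Z_scale unit_lattice_Z) simp
  have "span {0, real n *\<^sub>R unit 0} = space_R 1"
  proof
    show "span {0, real n *\<^sub>R unit 0} \<subseteq> space_R 1"
      using lattice lattice_Z_subset by (intro span_minimal subspace_space_R) auto
    show "space_R 1 \<subseteq> span {0, real n *\<^sub>R unit 0}"
    proof
      fix x assume "x \<in> space_R 1"
      then have "x = (poly_mapping.lookup x 0 / real n) *\<^sub>R (real n *\<^sub>R unit 0)"
        using space_R_expansion[of x 1] assms by simp
      then show "x \<in> span {0, real n *\<^sub>R unit 0}"
        by (metis insertCI span_base span_scale)
    qed
  qed
  moreover have "real n *\<^sub>R unit 0 \<noteq> 0"
    using assms by simp
  ultimately show ?thesis
    using lattice by (auto simp: pointed_lattice_set_def)
qed

lemma lattice_polytope_translation: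
  assumes "pointed_lattice_set s d C" "t \<in> lattice_Z d"
  shows "lattice_polytope d ((+) t ` (convex hull C))"
    and "s \<Longrightarrow> lattice_simplex d ((+) t ` (convex hull C))"
proof -
  have C: "finite C" "C \<subseteq> lattice_Z d" "0 \<in> C" "span C = space_R d" "s \<Longrightarrow> card C = Suc d"
    using assms(1) by (auto simp: pointed_lattice_set_def)
  have t: "t \<in> space_R d" using assms(2) lattice_Z_subset by auto
  have hull_eq: "(+) t ` (convex hull C) = convex hull ((+) t ` C)"
    by (simp add: convex_hull_translation)
  have "(+) t ` space_R d = space_R d"
  proof
    show "space_R d \<subseteq> (+) t ` space_R d"
      using t by (auto intro!: image_eqI[of _ _ "_ - t"] subspace_diff[OF subspace_space_R])
  qed (use t in \<open>auto intro!: subspace_add[OF subspace_space_R]\<close>)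
  moreover have "affine hull C = space_R d"
    using affine_hull_span_0[of C] C by (simp add: hull_inc)
  ultimately have "affine hull ((+) t ` (convex hull C)) = space_R d"
    by (simp add: affine_hull_translation)
  moreover have "v \<in> lattice_Z d" if "v extreme_point_of (+) t ` (convex hull C)" for v
    using extreme_point_of_convex_hull[of v "(+) t ` C"] that C assms(2)
    by (auto simp: hull_eq intro!: lattice_Z_add)
  moreover have "polytope ((+) t ` (convex hull C))"
    using C by (auto simp: polytope_def hull_eq)
  ultimately show poly: "lattice_polytope d ((+) t ` (convex hull C))"
    by (simp add: lattice_polytope_def)
  assume s
  have "independent (C - {0})"
  proof (rule independent_if_card_eq)
    show "span (C - {0}) = space_R d" using C by simp
  qed (use C \<open>s\<close> in auto)
  then have "\<not> affine_dependent C"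
    using affine_dependent_imp_dependent2[of "C - {0}"] C(3) by (auto simp: insert_absorb)
  then have "\<not> affine_dependent ((+) t ` C)"
    using affine_dependent_translation_eq by blast
  moreover have "card ((+) t ` C) = Suc d"
    using C(5)[OF \<open>s\<close>] by (simp add: card_image)
  ultimately show "lattice_simplex d ((+) t ` (convex hull C))"
    using poly unfolding lattice_simplex_def hull_eq by auto
qed

lemma lattice_polytope_pointed:
  assumes "lattice_polytope d K" "s \<Longrightarrow> lattice_simplex d K"
  obtains C t where "pointed_lattice_set s d C" "t \<in> lattice_Z d" "K = (+) t ` (convex hull C)"
proof -
  obtain D where D: "finite D" "K = convex hull D" "s \<Longrightarrow> \<not> affine_dependent D \<and> card D = Suc d"
  proof (cases s)
    case True
    then obtain D where "\<not> affine_dependent D" "int (card D) = int d + 1" "K = convex hull D"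
      using assms(2) by (auto simp: lattice_simplex_def)
    then show ?thesis
      by (intro that[of D]) (auto intro: card_ge_0_finite)
  next
    case False
    then show ?thesis
      using assms(1) that by (auto simp: lattice_polytope_def polytope_def)
  qed
  obtain E where E: "E \<subseteq> D" "convex hull E = K" "\<And>c. c \<in> E \<Longrightarrow> c \<notin> convex hull (E - {c})"
    using irredundant_generators[OF D(1)] D(2) by blast
  have "finite E" using E D finite_subset by blast
  have "E = D" if s
  proof (rule ccontr)
    assume "E \<noteq> D"
    then obtain a where a: "a \<in> D" "a \<notin> E" using E by blast
    then have "a \<in> convex hull E" using E D by (simp add: hull_inc)
    also have "\<dots> \<subseteq> affine hull E" by (rule convex_hull_subset_affine_hull)
    also have "\<dots> \<subseteq> affine hull (D - {a})" using a E by (intro hull_mono) blast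
    finally show False using D(3)[OF that] a by (auto simp: affine_dependent_def)
  qed
  have "E \<subseteq> lattice_Z d"
    using generators_are_extreme_points[OF \<open>finite E\<close>] E assms(1) by (auto simp: lattice_polytope_def)
  have aff: "affine hull E = space_R d"
    using assms(1) E(2) affine_hull_convex_hull[of E] by (simp add: lattice_polytope_def)
  then obtain t where t: "t \<in> E"
    by (metis affine_hull_eq_empty empty_iff ex_in_conv zero_space_R)
  have tZ: "t \<in> lattice_Z d" "t \<in> space_R d"
    using t \<open>E \<subseteq> lattice_Z d\<close> lattice_Z_subset by blast+
  define C where "C = (+) (- t) ` E"
  have "0 \<in> C" using t by (force simp: C_def)
  then have "span C = affine hull C"
    using affine_hull_span_0[of C] by (simp add: hull_inc)
  also have "\<dots> = (+) (- t) ` space_R d"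
    unfolding C_def affine_hull_translation aff ..
  also have "\<dots> = space_R d"
  proof
    show "space_R d \<subseteq> (+) (- t) ` space_R d"
      using tZ by (auto intro!: image_eqI[of _ _ "t + _"] subspace_add[OF subspace_space_R])
  qed (use tZ in \<open>auto intro!: subspace_diff[OF subspace_space_R] simp flip: diff_conv_add_uminus\<close>)
  finally have "span C = space_R d" .
  moreover have "C \<subseteq> lattice_Z d"
    using \<open>E \<subseteq> lattice_Z d\<close> tZ by (auto simp: C_def intro!: lattice_Z_diff)
  moreover have "card C = Suc d" if s
    using D(3)[OF that] \<open>s \<Longrightarrow> E = D\<close>[OF that] by (simp add: C_def card_image)
  ultimately have "pointed_lattice_set s d C"
    using \<open>0 \<in> C\<close> \<open>finite E\<close> by (auto simp: pointed_lattice_set_def C_def)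
  moreover have "K = (+) t ` (convex hull C)"
    unfolding convex_hull_translation[symmetric] C_def using E(2) by (simp add: image_image)
  ultimately show ?thesis
    using tZ that by blast
qed

lemma pointed_polytope_body:
  assumes "pointed_polytope s d K"
  shows "K \<subseteq> space_R d \<and> convex K \<and> bounded K \<and> 0 \<in> K"
proof -
  from assms obtain C where C: "finite C" "C \<subseteq> lattice_Z d" "0 \<in> C" "K = convex hull C"
    by (auto simp: pointed_polytope_def pointed_lattice_set_def)
  then have "K \<subseteq> space_R d"
    using lattice_Z_subset hull_minimal[of C "space_R d" convex] subspace_imp_convex[OF subspace_space_R]
    by blast
  then show ?thesis
    using C by (auto simp: hull_inc finite_imp_bounded_convex_hull)
qed

lemma body_family_lattice: "body_family (pointed_polytope s) lattice_Z (if s then w_s else w_p)"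
proof
  fix d K show "pointed_polytope s d K \<Longrightarrow> K \<subseteq> space_R d \<and> convex K \<and> bounded K \<and> 0 \<in> K"
    by (rule pointed_polytope_body)
next
  fix p q K L assume "pointed_polytope s p L" "pointed_polytope s q K"
  then obtain C D where CD: "pointed_lattice_set s p C" "pointed_lattice_set s q D"
    "L = convex hull C" "K = convex hull D"
    by (auto simp: pointed_polytope_def)
  then have "direct_sum p L K = convex hull (C \<union> shift p ` D)"
    using direct_sum_hull[of C D p] by (auto simp: pointed_lattice_set_def)
  then show "pointed_polytope s (p + q) (direct_sum p L K)"
    using pointed_lattice_set_Un[OF CD(1,2)] by (auto simp: pointed_polytope_def)
next
  fix d K and n :: nat assume "pointed_polytope s d K" "n \<ge> 1"
  then obtain C where "pointed_lattice_set s d ((*\<^sub>R) (real n) ` C)" "K = convex hull C"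
    unfolding pointed_polytope_def using pointed_lattice_set_scale by blast
  then show "pointed_polytope s d ((*\<^sub>R) (real n) ` K)"
    unfolding pointed_polytope_def using convex_hull_scaling[of "real n" C] by auto
next
  fix n :: nat assume "n \<ge> 1"
  then show "pointed_polytope s 1 (convex hull {0, real n *\<^sub>R unit 0})"
    unfolding pointed_polytope_def using pointed_lattice_set_segment by blast
next
  fix t1 t2 p q assume "t1 \<in> lattice_Z p" "t2 \<in> lattice_Z q"
  then show "t1 + shift p t2 \<in> lattice_Z (p + q)"
    using lattice_Z_mono[of p "p + q"] by (auto intro!: lattice_Z_add shift_lattice_Z)
next
  fix d K t assume K: "pointed_polytope s d K" "t \<in> lattice_Z d" "misses d t K"
  then have "hollow d ((+) t ` K)"
    using pointed_polytope_body[OF K(1)] lattice_Z_subset by (subst hollow_translation_iff) auto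
  moreover have "lattice_polytope d ((+) t ` K)" "s \<Longrightarrow> lattice_simplex d ((+) t ` K)"
    using K lattice_polytope_translation by (auto simp: pointed_polytope_def)
  ultimately show "ereal (lattice_width d ((+) t ` K)) \<le> (if s then w_s else w_p) d"
    unfolding w_s_def w_p_def by (auto intro!: SUP_upper)
next
  fix c d assume "ereal c < (if s then w_s else w_p) d"
  then obtain K where K: "lattice_polytope d K" "s \<Longrightarrow> lattice_simplex d K" "hollow d K" "c < lattice_width d K"
    by (auto simp: w_s_def w_p_def less_SUP_iff lattice_simplex_def split: if_splits)
  then obtain C t where C: "pointed_lattice_set s d C" "t \<in> lattice_Z d" "K = (+) t ` (convex hull C)"
    using lattice_polytope_pointed by metis
  then have P: "pointed_polytope s d (convex hull C)" by (auto simp: pointed_polytope_def)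
  moreover have "misses d t (convex hull C)"
    using hollow_translation_iff[of "convex hull C" d t] pointed_polytope_body[OF P] K(3) C lattice_Z_subset by auto
  ultimately show "\<exists>K t. pointed_polytope s d K \<and> t \<in> lattice_Z d \<and> misses d t K \<and> c < lattice_width d ((+) t ` K)"
    using C K(4) by blast
qed (auto simp: lattice_Z_subset[THEN subsetD])

theorem theorem1p5:
  fixes w :: "nat \<Rightarrow> ereal"
  assumes "w \<in> {w_s, w_p, w_c}"
  shows "(\<lambda>d. w d / ereal (real d)) \<longlonglongrightarrow> (SUP d\<in>{1..}. w d / ereal (real d))"
proof -
  from assms consider "w = w_s" | "w = w_p" | "w = w_c" by blast
  then show ?thesis
  proof cases
    case 1
    then show ?thesis using body_family.limit[OF body_family_lattice[of True]] by simp
  next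
    case 2
    then show ?thesis using body_family.limit[OF body_family_lattice[of False]] by simp
  next
    case 3
    then show ?thesis using body_family.limit[OF body_family_convex] by simp
  qed
qed

end
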